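(* $q$-Laplacian perfect pair state transfer can be achieved in a cycle with at least eight vertices by inserting exactly four suitable edges. That is, for every non-zero real $q$ and every $n\ge 8$ there exist four edges, not in the cycle $C_n$, whose addition to $C_n$ yields a (simple, unweighted) graph that exhibits perfect pair state transfer with respect to its $q$-Laplacian matrix.
   Context: $C_n$ is the cycle on $n$ vertices. For a non-zero real number $q$ and a graph with adjacency matrix $A$ and diagonal degree matrix $\Delta$, the $q$-Laplacian matrix is $\mathscr{L}=(1-q^2)I+q^2\Delta-qA$. A pair state is a vector $\frac{1}{\sqrt2}(\mathbf{e}_a-\mathbf{e}_b)$ with $a\ne b$ vertices, where $\mathbf{e}_a$ is the characteristic vector of $a$. Perfect pair state transfer with respect to $\mathscr{L}$ means there are two linearly independent pair states $\mathbf{x},\mathbf{y}$, some $\tau>0$ and $\gamma\in\mathbb{C}$ with $\exp(i\tau\mathscr{L})\mathbf{x}=\gamma\mathbf{y}$. *)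

theory Defs
  imports Complex_Main "Jordan_Normal_Form.Matrix" "Jordan_Normal_Form.VS_Connect"
begin

text \<open>
  A simple graph on the vertex set \<open>{..<n}\<close> is given by its edge set, a subset of
  \<open>vertex_pairs n\<close>.
\<close>

definition vertex_pairs :: "nat \<Rightarrow> nat set set" where
  "vertex_pairs n = {e. e \<subseteq> {..<n} \<and> card e = 2}"

text \<open>These are the edges of the cycle on \<open>n\<close> vertices only for \<open>n \<ge> 3\<close>.\<close>

definition cycle_edges :: "nat \<Rightarrow> nat set set" where
  "cycle_edges n = {{i, (i + 1) mod n} | i. i < n}"

definition adjacency_mat :: "nat \<Rightarrow> nat set set \<Rightarrow> real mat" where
  "adjacency_mat n E = mat n n (\<lambda>(i, j). if {i, j} \<in> E then 1 else 0)"

definition degree_mat :: "nat \<Rightarrow> nat set set \<Rightarrow> real mat" where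
  "degree_mat n E = mat n n (\<lambda>(i, j). if i = j then real (card {e \<in> E. i \<in> e}) else 0)"

definition q_laplacian :: "real \<Rightarrow> nat \<Rightarrow> nat set set \<Rightarrow> real mat" where
  "q_laplacian q n E =
     (1 - q^2) \<cdot>\<^sub>m 1\<^sub>m n + q^2 \<cdot>\<^sub>m degree_mat n E - q \<cdot>\<^sub>m adjacency_mat n E"

text \<open>
  The matrix exponential of a square matrix, summed entrywise; the series converge by
  \<open>summable_mat_exp\<close> below.
\<close>

definition mat_exp :: "complex mat \<Rightarrow> complex mat" where
  "mat_exp A = mat (dim_row A) (dim_row A) (\<lambda>(i, j). \<Sum>k. (A ^\<^sub>m k) $$ (i, j) / fact k)"

lemma summable_mat_exp:
  fixes A :: "complex mat"
  assumes A: "A \<in> carrier_mat n n" and i: "i < n" and j: "j < n"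
  shows "summable (\<lambda>k. (A ^\<^sub>m k) $$ (i, j) / fact k)"
proof -
  define M where "M = (\<Sum>(r, c)\<in>{..<n} \<times> {..<n}. norm (A $$ (r, c)))"
  have M: "norm (A $$ (r, c)) \<le> M" if "r < n" "c < n" for r c
    unfolding M_def
    using that member_le_sum[of "(r, c)" "{..<n} \<times> {..<n}" "\<lambda>(r, c). norm (A $$ (r, c))"]
    by auto
  have bound: "norm ((A ^\<^sub>m k) $$ (i, l)) \<le> (real n * M) ^ k" if "l < n" for k l
    using that
  proof (induction k arbitrary: l)
    case 0
    then show ?case using A i by (auto simp: one_mat_def)
  next
    case (Suc k)
    have "(A ^\<^sub>m Suc k) $$ (i, l) = (\<Sum>m<n. (A ^\<^sub>m k) $$ (i, m) * A $$ (m, l))"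
      using A i Suc.prems pow_carrier_mat[OF A, of k]
      by (auto simp: scalar_prod_def lessThan_atLeast0)
    also have "norm \<dots> \<le> (\<Sum>m<n. (real n * M) ^ k * M)"
      using Suc by (intro sum_norm_le) (auto simp: norm_mult intro!: mult_mono M order_trans[OF norm_ge_zero])
    also have "\<dots> = (real n * M) ^ Suc k" by (simp add: algebra_simps)
    finally show ?case .
  qed
  have "summable (\<lambda>k. (real n * M) ^ k /\<^sub>R fact k)"
    by (rule summable_exp_generic)
  then show ?thesis
    by (rule summable_comparison_test')
       (use bound j in \<open>auto simp: norm_divide field_simps simp flip: power_mult_distrib\<close>)
qed

definition pair_state :: "nat \<Rightarrow> nat \<Rightarrow> nat \<Rightarrow> complex vec" where
  "pair_state n a b = complex_of_real (1 / sqrt 2) \<cdot>\<^sub>v (unit_vec n a - unit_vec n b)"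

definition is_pair_state :: "nat \<Rightarrow> complex vec \<Rightarrow> bool" where
  "is_pair_state n x \<longleftrightarrow> (\<exists>a<n. \<exists>b<n. a \<noteq> b \<and> x = pair_state n a b)"

text \<open>
  The library's linear dependence speaks about sets of vectors, so \<open>x \<noteq> y\<close> is required
  separately.
\<close>

definition perfect_pair_state_transfer :: "nat \<Rightarrow> real mat \<Rightarrow> bool" where
  "perfect_pair_state_transfer n L \<longleftrightarrow>
     (\<exists>x y \<tau> \<gamma>. is_pair_state n x \<and> is_pair_state n y
        \<and> x \<noteq> y \<and> \<not> module.lin_dep class_ring (module_vec TYPE(complex) n) {x, y}
        \<and> \<tau> > 0
        \<and> mat_exp ((\<i> * complex_of_real \<tau>) \<cdot>\<^sub>m map_mat complex_of_real L) *\<^sub>v x = \<gamma> \<cdot>\<^sub>v y)"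

end

theory Submission imports Defs begin

text \<open>
  The idea is to find two disjoint pairs of vertices \<open>a, b\<close> and \<open>c, d\<close> that behave like the
  two ends of a single edge. Suppose that \<open>a\<close> and \<open>b\<close> have the same neighbours \<open>S\<close>, except that \<open>a\<close>
  is adjacent to \<open>c\<close> and \<open>b\<close> to \<open>d\<close>; and that \<open>c\<close> and \<open>d\<close> have the same neighbours \<open>T\<close> apart
  from \<open>a\<close> and \<open>b\<close>. In \<open>A (e\<^sub>a - e\<^sub>b)\<close> the contributions of \<open>S\<close> cancel and \<open>e\<^sub>c - e\<^sub>d\<close> remains, and
  symmetrically. If moreover \<open>S\<close> and \<open>T\<close> have the same size \<open>s\<close>, then all four degrees are \<open>s + 1\<close>,
  so the \<open>q\<close>-Laplacian maps the plane spanned by the two pair states to itself, acting there as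
  \<open>(1 + q\<^sup>2 s) I - q X\<close>, where \<open>X\<close> swaps the two states. The exponential of such an operator moves
  one state onto the other at time \<open>\<pi> / (2\<bar>q\<bar>)\<close>, as in perfect state transfer along an edge. This is
  \<open>perfect_pair_state_transfer_of_neighbours\<close>.

  Four chords create this configuration in a cycle. Consider its arc
  \<open>0, c = 1, a = 2, 3, b = 4, d = 5, 6, 7\<close>. The cycle already joins \<open>a\<close> to \<open>c\<close> and \<open>b\<close> to \<open>d\<close>, and
  gives \<open>a\<close> and \<open>b\<close> the common neighbour \<open>3\<close>. The chords from \<open>1\<close> to \<open>6\<close> and from \<open>5\<close> to \<open>0\<close> make
  \<open>0\<close> and \<open>6\<close> common neighbours of \<open>c\<close> and \<open>d\<close>. This raises the degrees of \<open>c\<close> and \<open>d\<close> to three, so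
  \<open>a\<close> and \<open>b\<close> are given one more common neighbour, \<open>7\<close>, by the other two chords.
\<close>

section \<open>The matrix exponential on an invariant plane\<close>

lemma pow_mat_mult_eigenvector:
  fixes A :: "'a :: field mat"
  assumes A: "A \<in> carrier_mat n n" and x: "x \<in> carrier_vec n"
    and eig: "A *\<^sub>v x = c \<cdot>\<^sub>v x"
  shows "(A ^\<^sub>m k) *\<^sub>v x = c ^ k \<cdot>\<^sub>v x"
proof (induction k)
  case 0
  then show ?case using A x by simp
next
  case (Suc k)
  have "(A ^\<^sub>m Suc k) *\<^sub>v x = (A ^\<^sub>m k) *\<^sub>v (c \<cdot>\<^sub>v x)"
    using assoc_mult_mat_vec[OF pow_carrier_mat[OF A] A x] eig by simp
  also have "\<dots> = c \<cdot>\<^sub>v (c ^ k \<cdot>\<^sub>v x)"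
    using mult_mat_vec[OF pow_carrier_mat[OF A] x] Suc by simp
  finally show ?case by (simp add: smult_smult_assoc)
qed

text \<open>
  The exponential is defined entrywise, so the finite sum over the matrix row has to be moved inside
  the series; what is left is the exponential series of the eigenvalue.
\<close>

lemma mat_exp_mult_eigenvector:
  assumes A: "A \<in> carrier_mat n n" and x: "x \<in> carrier_vec n"
    and eig: "A *\<^sub>v x = c \<cdot>\<^sub>v x"
  shows "mat_exp A *\<^sub>v x = exp c \<cdot>\<^sub>v x"
proof (rule eq_vecI)
  show "dim_vec (mat_exp A *\<^sub>v x) = dim_vec (exp c \<cdot>\<^sub>v x)"
    using A x by (simp add: mat_exp_def)
next
  fix i assume "i < dim_vec (exp c \<cdot>\<^sub>v x)"
  then have i: "i < n" using x by simp
  have "(mat_exp A *\<^sub>v x) $ i = (\<Sum>j<n. (\<Sum>k. (A ^\<^sub>m k) $$ (i, j) / fact k) * x $ j)"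
    using A x i by (simp add: mat_exp_def scalar_prod_def lessThan_atLeast0)
  moreover have "(\<lambda>k. \<Sum>j<n. (A ^\<^sub>m k) $$ (i, j) / fact k * x $ j) sums
      (\<Sum>j<n. (\<Sum>k. (A ^\<^sub>m k) $$ (i, j) / fact k) * x $ j)"
    by (intro sums_sum sums_mult2 summable_sums summable_mat_exp[OF A i]) simp
  moreover have "(\<Sum>j<n. (A ^\<^sub>m k) $$ (i, j) / fact k * x $ j) = c ^ k /\<^sub>R fact k * x $ i" for k
  proof -
    have "(\<Sum>j<n. (A ^\<^sub>m k) $$ (i, j) * x $ j) = ((A ^\<^sub>m k) *\<^sub>v x) $ i"
      using carrier_matD[OF pow_carrier_mat[OF A, of k]] x i
      by (simp add: scalar_prod_def lessThan_atLeast0)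
    also have "\<dots> = c ^ k * x $ i"
      using pow_mat_mult_eigenvector[OF A x eig] x i by simp
    finally show ?thesis
      by (simp add: sum_divide_distrib[symmetric] scaleR_conv_of_real divide_inverse mult_ac
          flip: sum_distrib_left)
  qed
  moreover have "(\<lambda>k. c ^ k /\<^sub>R fact k * x $ i) sums (exp c * x $ i)"
    by (intro sums_mult2 exp_converges)
  ultimately show "(mat_exp A *\<^sub>v x) $ i = (exp c \<cdot>\<^sub>v x) $ i"
    using x i by (simp add: sums_iff)
qed

lemma smult_mat_mult_vec:
  fixes A :: "'a :: comm_semiring_0 mat"
  assumes "A \<in> carrier_mat m n" "x \<in> carrier_vec n"
  shows "(c \<cdot>\<^sub>m A) *\<^sub>v x = c \<cdot>\<^sub>v (A *\<^sub>v x)"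
  using assms by (intro eq_vecI) (auto simp: scalar_prod_def sum_distrib_left mult_ac intro!: sum.cong)

text \<open>
  The vectors \<open>x + y\<close> and \<open>x - y\<close> are eigenvectors for \<open>m + \<mu>\<close> and \<open>m - \<mu>\<close>. Averaging their two
  evolutions gives \<open>e\<^sup>i\<^sup>\<tau>\<^sup>m (cos (\<tau> \<mu>) x + i sin (\<tau> \<mu>) y)\<close>, and the choice of \<open>\<tau>\<close> removes the first
  term.
\<close>

lemma mat_exp_transfer_of_coupled_vectors:
  fixes m \<mu> :: real
  assumes A: "A \<in> carrier_mat n n" and x: "x \<in> carrier_vec n" and y: "y \<in> carrier_vec n"
    and Ax: "A *\<^sub>v x = complex_of_real m \<cdot>\<^sub>v x + complex_of_real \<mu> \<cdot>\<^sub>v y"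
    and Ay: "A *\<^sub>v y = complex_of_real m \<cdot>\<^sub>v y + complex_of_real \<mu> \<cdot>\<^sub>v x"
    and \<tau>: "cos (\<tau> * \<mu>) = 0"
  shows "mat_exp ((\<i> * complex_of_real \<tau>) \<cdot>\<^sub>m A) *\<^sub>v x =
    (\<i> * sin (\<tau> * \<mu>) * cis (\<tau> * m)) \<cdot>\<^sub>v y"
proof -
  define M where "M = (\<i> * complex_of_real \<tau>) \<cdot>\<^sub>m A"
  define E where "E = mat_exp M"
  have M: "M \<in> carrier_mat n n" and E: "E \<in> carrier_mat n n"
    using A by (auto simp: M_def E_def mat_exp_def)
  have exp_cis: "exp (\<i> * complex_of_real t) = cis t" for t
    by (simp add: cis_conv_exp)
  have plus: "E *\<^sub>v (x + y) = cis (\<tau> * (m + \<mu>)) \<cdot>\<^sub>v (x + y)"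
  proof -
    have "M *\<^sub>v (x + y) = (\<i> * complex_of_real (\<tau> * (m + \<mu>))) \<cdot>\<^sub>v (x + y)"
      unfolding M_def using A x y
      by (subst smult_mat_mult_vec[OF A])
        (auto simp: mult_add_distrib_mat_vec[OF A x y] Ax Ay algebra_simps intro!: eq_vecI)
    from mat_exp_mult_eigenvector[OF M _ this] x y show ?thesis
      unfolding E_def exp_cis by simp
  qed
  have minus: "E *\<^sub>v (x - y) = cis (\<tau> * (m - \<mu>)) \<cdot>\<^sub>v (x - y)"
  proof -
    have "M *\<^sub>v (x - y) = (\<i> * complex_of_real (\<tau> * (m - \<mu>))) \<cdot>\<^sub>v (x - y)"
      unfolding M_def using A x y
      by (subst smult_mat_mult_vec[OF A])
        (auto simp: mult_minus_distrib_mat_vec[OF A x y] Ax Ay algebra_simps intro!: eq_vecI)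
    from mat_exp_mult_eigenvector[OF M _ this] x y show ?thesis
      unfolding E_def exp_cis by simp
  qed
  have cis_pm: "cis (\<tau> * (m + \<mu>)) = \<i> * sin (\<tau> * \<mu>) * cis (\<tau> * m)"
    "cis (\<tau> * (m - \<mu>)) = - (\<i> * sin (\<tau> * \<mu>) * cis (\<tau> * m))"
    using \<tau> by (auto simp: complex_eq_iff algebra_simps cos_add sin_add cos_diff sin_diff)
  have "2 \<cdot>\<^sub>v (E *\<^sub>v x) = E *\<^sub>v (x + y) + E *\<^sub>v (x - y)"
    using E x y
    by (intro eq_vecI)
      (auto simp: mult_add_distrib_mat_vec[OF E x y] mult_minus_distrib_mat_vec[OF E x y])
  also have "\<dots> = 2 \<cdot>\<^sub>v ((\<i> * sin (\<tau> * \<mu>) * cis (\<tau> * m)) \<cdot>\<^sub>v y)"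
    unfolding plus minus cis_pm using x y by (intro eq_vecI) (auto simp: algebra_simps)
  finally have *: "2 \<cdot>\<^sub>v (E *\<^sub>v x) = 2 \<cdot>\<^sub>v ((\<i> * sin (\<tau> * \<mu>) * cis (\<tau> * m)) \<cdot>\<^sub>v y)" .
  have "inverse 2 \<cdot>\<^sub>v (2 \<cdot>\<^sub>v v) = v" for v :: "complex vec"
    by (simp add: smult_smult_assoc)
  from this[of "E *\<^sub>v x"] show ?thesis
    unfolding * by (simp add: smult_smult_assoc E_def M_def)
qed

section \<open>Pair states\<close>

lemma mult_mat_vec_pair_state:
  assumes A: "A \<in> carrier_mat n n" and "a < n" "b < n" and i: "i < n"
  shows "(A *\<^sub>v pair_state n a b) $ i = complex_of_real (1 / sqrt 2) * (A $$ (i, a) - A $$ (i, b))"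
proof -
  have col: "(A *\<^sub>v unit_vec n k) $ i = A $$ (i, k)" if "k < n" for k
    using A i that scalar_prod_right_unit[of k n "row A i"] by simp
  have "A *\<^sub>v pair_state n a b =
      complex_of_real (1 / sqrt 2) \<cdot>\<^sub>v (A *\<^sub>v unit_vec n a - A *\<^sub>v unit_vec n b)"
    unfolding pair_state_def
    by (subst mult_mat_vec[OF A]) (auto simp: mult_minus_distrib_mat_vec[OF A])
  moreover have "dim_vec (A *\<^sub>v unit_vec n b) = n" "dim_vec (A *\<^sub>v unit_vec n a) = n"
    using A by auto
  ultimately show ?thesis
    using i col[OF \<open>a < n\<close>] col[OF \<open>b < n\<close>] by simp
qed

lemma pair_state_index:
  assumes "a < n" "b < n" "i < n"
  shows "pair_state n a b $ i = complex_of_real (1 / sqrt 2) * (of_bool (i = a) - of_bool (i = b))"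
  using assms by (auto simp: pair_state_def)

lemma lin_indpt_disjoint_pair_states:
  assumes less: "a < n" "b < n" "c < n" "d < n" and dist: "distinct [a, b, c, d]"
  shows "\<not> module.lin_dep class_ring (module_vec TYPE(complex) n) {pair_state n a b, pair_state n c d}"
proof -
  interpret vec_space "TYPE(complex)" n .
  let ?x = "pair_state n a b" and ?y = "pair_state n c d"
  have car: "?x \<in> carrier_vec n" "?y \<in> carrier_vec n"
    by (auto simp: pair_state_def)
  have ne: "?x \<noteq> ?y"
    using pair_state_index[of a n b a] pair_state_index[of c n d a] less dist by auto
  show ?thesis
  proof (rule finite_lin_indpt2)
    fix f
    assume lc: "lincomb f {?x, ?y} = 0\<^sub>v n"
    have "(f ?x * ?x $ i + f ?y * ?y $ i) = 0" if i: "i < n" for i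
      using lincomb_index[of i "{?x, ?y}" f] i lc car ne by simp
    \<comment> \<open>Coordinate \<open>a\<close> sees only the first state and coordinate \<open>c\<close> only the second.\<close>
    from this[of a] this[of c] show "\<forall>v\<in>{?x, ?y}. f v = 0"
      using less dist by (auto simp: pair_state_index)
  qed (use car in auto)
qed

section \<open>Coupled pairs of vertices in a graph\<close>

definition neighbours :: "nat set set \<Rightarrow> nat \<Rightarrow> nat set" where
  "neighbours E i = {j. {i, j} \<in> E}"

lemma degree_eq_card_neighbours:
  assumes "E \<subseteq> vertex_pairs n"
  shows "card {e \<in> E. i \<in> e} = card (neighbours E i)"
proof -
  have "{e \<in> E. i \<in> e} = (\<lambda>j. {i, j}) ` neighbours E i"
  proof safe
    fix e assume "e \<in> E" "i \<in> e"
    moreover from this assms have "card e = 2" by (auto simp: vertex_pairs_def)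
    ultimately obtain j where "e = {i, j}"
      by (auto simp: card_2_iff)
    with \<open>e \<in> E\<close> show "e \<in> (\<lambda>j. {i, j}) ` neighbours E i"
      by (auto simp: neighbours_def)
  qed (auto simp: neighbours_def)
  moreover have "inj_on (\<lambda>j. {i, j}) (neighbours E i)"
    by (auto simp: inj_on_def doubleton_eq_iff)
  ultimately show ?thesis by (simp add: card_image)
qed

lemma q_laplacian_carrier: "q_laplacian q n E \<in> carrier_mat n n"
  by (intro carrier_matI) (simp_all add: q_laplacian_def degree_mat_def adjacency_mat_def)

lemma q_laplacian_index:
  assumes "E \<subseteq> vertex_pairs n" "i < n" "j < n"
  shows "q_laplacian q n E $$ (i, j) =
    of_bool (i = j) * (1 - q^2 + q^2 * real (card (neighbours E j))) - q * of_bool (i \<in> neighbours E j)"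
  using assms degree_eq_card_neighbours[OF assms(1)]
  by (auto simp: q_laplacian_def degree_mat_def adjacency_mat_def neighbours_def insert_commute)

text \<open>
  Column \<open>a\<close> minus column \<open>b\<close> of the adjacency matrix is the indicator of \<open>insert c S\<close> minus that
  of \<open>insert d S\<close>. The degree \<open>card S + 1\<close> combines with \<open>1 - q\<^sup>2\<close> to the diagonal coefficient
  \<open>1 + q\<^sup>2 card S\<close>.
\<close>

lemma q_laplacian_mult_pair_state:
  assumes E: "E \<subseteq> vertex_pairs n"
    and less: "a < n" "b < n" "c < n" "d < n" and dist: "distinct [a, b, c, d]"
    and Na: "neighbours E a = insert c S" and Nb: "neighbours E b = insert d S"
    and S: "finite S" "S \<inter> {c, d} = {}"
  shows "map_mat complex_of_real (q_laplacian q n E) *\<^sub>v pair_state n a b =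
    complex_of_real (1 + q^2 * card S) \<cdot>\<^sub>v pair_state n a b
      + complex_of_real (- q) \<cdot>\<^sub>v pair_state n c d"
proof (rule eq_vecI)
  let ?L = "map_mat complex_of_real (q_laplacian q n E)"
  have L: "?L \<in> carrier_mat n n" using q_laplacian_carrier by simp
  show "dim_vec (?L *\<^sub>v pair_state n a b) = dim_vec (complex_of_real (1 + q^2 * card S) \<cdot>\<^sub>v pair_state n a b
      + complex_of_real (- q) \<cdot>\<^sub>v pair_state n c d)"
    using L by (simp add: pair_state_def)
  fix i assume "i < dim_vec (complex_of_real (1 + q^2 * card S) \<cdot>\<^sub>v pair_state n a b
      + complex_of_real (- q) \<cdot>\<^sub>v pair_state n c d)"
  then have i: "i < n" by (simp add: pair_state_def)
  have card: "card (neighbours E a) = Suc (card S)" "card (neighbours E b) = Suc (card S)"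
    using S by (simp_all add: Na Nb)
  have idx: "?L $$ (i, j) = complex_of_real (q_laplacian q n E $$ (i, j))" if "j < n" for j
    using L i that by simp
  have dim: "dim_vec (pair_state n u v) = n" for u v by (simp add: pair_state_def)
  have "q_laplacian q n E $$ (i, a) - q_laplacian q n E $$ (i, b) =
      (1 + q^2 * card S) * (of_bool (i = a) - of_bool (i = b))
        + (- q) * (of_bool (i = c) - of_bool (i = d))"
    unfolding q_laplacian_index[OF E i less(1)] q_laplacian_index[OF E i less(2)] card
    using dist S by (auto simp: Na Nb algebra_simps)
  moreover have "complex_of_real (of_bool P) = of_bool P" for P
    by (cases P) simp_all
  ultimately have "?L $$ (i, a) - ?L $$ (i, b) =
      complex_of_real (1 + q^2 * card S) * (of_bool (i = a) - of_bool (i = b))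
        + complex_of_real (- q) * (of_bool (i = c) - of_bool (i = d))"
    unfolding idx[OF less(1)] idx[OF less(2)] of_real_diff[symmetric]
    by (simp only: of_real_add of_real_mult of_real_diff)
  then show "(?L *\<^sub>v pair_state n a b) $ i = (complex_of_real (1 + q^2 * card S) \<cdot>\<^sub>v pair_state n a b
      + complex_of_real (- q) \<cdot>\<^sub>v pair_state n c d) $ i"
    unfolding mult_mat_vec_pair_state[OF L less(1,2) i]
    using i less by (simp only: index_add_vec index_smult_vec pair_state_index dim) (simp add: ring_distribs mult_ac)
qed

text \<open>
  The requirement \<open>card S = card T\<close> equalises the degrees of the two pairs, hence the two diagonal
  coefficients; without this, the two states would in general be mixed but not exchanged.
\<close>

lemma perfect_pair_state_transfer_of_neighbours:
  assumes E: "E \<subseteq> vertex_pairs n"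
    and less: "a < n" "b < n" "c < n" "d < n" and dist: "distinct [a, b, c, d]"
    and N: "neighbours E a = insert c S" "neighbours E b = insert d S"
      "neighbours E c = insert a T" "neighbours E d = insert b T"
    and fin: "finite S" "finite T" and S: "S \<inter> {c, d} = {}" and T: "T \<inter> {a, b} = {}"
    and card: "card S = card T" and q: "q \<noteq> 0"
  shows "perfect_pair_state_transfer n (q_laplacian q n E)"
proof -
  let ?x = "pair_state n a b" and ?y = "pair_state n c d"
  let ?L = "map_mat complex_of_real (q_laplacian q n E)"
  define \<tau> where "\<tau> = pi / (2 * \<bar>q\<bar>)"
  have L: "?L \<in> carrier_mat n n" using q_laplacian_carrier by simp
  have car: "?x \<in> carrier_vec n" "?y \<in> carrier_vec n"
    by (auto simp: pair_state_def)
  have Lx: "?L *\<^sub>v ?x = complex_of_real (1 + q^2 * card S) \<cdot>\<^sub>v ?x + complex_of_real (- q) \<cdot>\<^sub>v ?y"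
    using q_laplacian_mult_pair_state[OF E less dist N(1,2) fin(1) S] .
  have "distinct [c, d, a, b]" using dist by auto
  from q_laplacian_mult_pair_state[OF E less(3,4,1,2) this N(3,4) fin(2) T]
  have Ly: "?L *\<^sub>v ?y = complex_of_real (1 + q^2 * card S) \<cdot>\<^sub>v ?y + complex_of_real (- q) \<cdot>\<^sub>v ?x"
    unfolding card .
  \<comment> \<open>The coupling constant is \<open>- q\<close>, and \<open>q\<close> may have either sign.\<close>
  have "\<tau> * - q = pi / 2 \<or> \<tau> * - q = - (pi / 2)"
    using q by (auto simp: \<tau>_def abs_if)
  then have "cos (\<tau> * - q) = 0" by (metis cos_minus cos_pi_half)
  from mat_exp_transfer_of_coupled_vectors[OF L car Lx Ly this]
  obtain \<gamma> where "mat_exp ((\<i> * complex_of_real \<tau>) \<cdot>\<^sub>m ?L) *\<^sub>v ?x = \<gamma> \<cdot>\<^sub>v ?y" by blast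
  moreover have "\<tau> > 0" using q by (simp add: \<tau>_def)
  moreover have "?x \<noteq> ?y"
    using pair_state_index[of a n b a] pair_state_index[of c n d a] less dist by auto
  moreover have "is_pair_state n ?x" "is_pair_state n ?y"
    using less dist by (auto simp: is_pair_state_def)
  ultimately show ?thesis
    unfolding perfect_pair_state_transfer_def
    using lin_indpt_disjoint_pair_states[OF less dist] by blast
qed

section \<open>Adding four chords to a cycle\<close>

lemma doubleton_in_cycle_edges_iff:
  "{i, j} \<in> cycle_edges n \<longleftrightarrow> (i < n \<and> j = (i + 1) mod n) \<or> (j < n \<and> i = (j + 1) mod n)"
  by (auto simp: cycle_edges_def doubleton_eq_iff)

lemma neighbours_cycle_edges:
  assumes "0 < i" "i + 1 < n"
  shows "neighbours (cycle_edges n) i = {i - 1, i + 1}"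
proof -
  have "j = i - 1" if "j < n" "i = Suc j mod n" for j
    using that assms by (cases "Suc j = n") auto
  with assms show ?thesis
    by (auto simp: neighbours_def doubleton_in_cycle_edges_iff)
qed

lemma cycle_edges_subset_vertex_pairs:
  assumes "n \<ge> 2"
  shows "cycle_edges n \<subseteq> vertex_pairs n"
proof
  fix e assume "e \<in> cycle_edges n"
  then obtain i where i: "i < n" "e = {i, (i + 1) mod n}" by (auto simp: cycle_edges_def)
  then have "(i + 1) mod n \<noteq> i" using assms by (cases "i + 1 = n") auto
  with i show "e \<in> vertex_pairs n" by (auto simp: vertex_pairs_def card_2_iff)
qed

lemma neighbours_Un: "neighbours (E \<union> F) i = neighbours E i \<union> neighbours F i"
  by (auto simp: neighbours_def)

theorem theorem7:
  fixes q :: real and n :: nat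
  assumes "q \<noteq> 0" and "n \<ge> 8"
  shows "\<exists>F. F \<subseteq> vertex_pairs n - cycle_edges n \<and> card F = 4
           \<and> perfect_pair_state_transfer n (q_laplacian q n (cycle_edges n \<union> F))"
proof -
  define F :: "nat set set" where "F = {{2, 7}, {4, 7}, {1, 6}, {5, 0}}"
  have "F \<subseteq> vertex_pairs n"
    using assms by (auto simp: F_def vertex_pairs_def)
  moreover have "F \<inter> cycle_edges n = {}"
    \<comment> \<open>Vertex \<open>7\<close> is adjacent to \<open>0\<close> in the cycle exactly when \<open>n = 8\<close>.\<close>
    using assms by (cases "n = 8") (auto simp: F_def doubleton_in_cycle_edges_iff)
  moreover have "card F = 4"
    by (simp add: F_def doubleton_eq_iff)
  moreover have "perfect_pair_state_transfer n (q_laplacian q n (cycle_edges n \<union> F))"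
  proof (rule perfect_pair_state_transfer_of_neighbours[where a = 2 and b = 4 and c = 1 and d = 5
          and S = "{3, 7}" and T = "{0, 6}"])
    show "cycle_edges n \<union> F \<subseteq> vertex_pairs n"
      using cycle_edges_subset_vertex_pairs[of n] \<open>F \<subseteq> vertex_pairs n\<close> assms by simp
    have "neighbours F 2 = {7}" "neighbours F 4 = {7}" "neighbours F 1 = {6}" "neighbours F 5 = {0}"
      by (auto simp: F_def neighbours_def doubleton_eq_iff)
    then show "neighbours (cycle_edges n \<union> F) 2 = insert 1 {3, 7}"
      "neighbours (cycle_edges n \<union> F) 4 = insert 5 {3, 7}"
      "neighbours (cycle_edges n \<union> F) 1 = insert 2 {0, 6}"
      "neighbours (cycle_edges n \<union> F) 5 = insert 4 {0, 6}"
      using assms by (auto simp: neighbours_Un neighbours_cycle_edges)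
  qed (use assms in auto)
  ultimately show ?thesis by blast
qed

end
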